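(* Let $n,d\ge 1$ be integers, $\ell(d)=\binom{n+d-1}{d}$, $k=n/(2d\,\ell(d))$, let $\tilde{\mathbf{v}}_d(\mathbf{x})\in\mathbb{R}^{\ell(d)}$ be the vector of all monomials $\mathbf{x}^\alpha$ of degree $|\alpha|=d$, and let $\mathcal{S}^{++}_{\ell(d)}$ be the cone of real symmetric positive definite $\ell(d)\times\ell(d)$ matrices. Define $\theta_d:\mathcal{S}^{++}_{\ell(d)}\to\mathbb{R}$ by $$\theta_d(\Sigma):=(\det\Sigma)^k\int_{\mathbb{R}^n}\exp(-k\,\tilde{\mathbf{v}}_d(\mathbf{x})^T\Sigma\,\tilde{\mathbf{v}}_d(\mathbf{x}))\,d\mathbf{x},$$ and let $$\mathbf{M}_d(\Sigma):=\frac{\int_{\mathbb{R}^n}\tilde{\mathbf{v}}_d(\mathbf{x})\tilde{\mathbf{v}}_d(\mathbf{x})^T\exp(-k\,\tilde{\mathbf{v}}_d(\mathbf{x})^T\Sigma\,\tilde{\mathbf{v}}_d(\mathbf{x}))\,d\mathbf{x}}{\int_{\mathbb{R}^n}\exp(-k\,\tilde{\mathbf{v}}_d(\mathbf{x})^T\Sigma\,\tilde{\mathbf{v}}_d(\mathbf{x}))\,d\mathbf{x}}.$$ Then $\langle\mathbf{M}_d(\Sigma),\Sigma\rangle=\ell(d)$ for all $\Sigma\in\mathcal{S}^{++}_{\ell(d)}$, and $\nabla\theta_d(\Sigma)=0$ if $\mathbf{M}_d(\Sigma)=\Sigma^{-1}$.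
   Context: $\langle\mathbf{B},\mathbf{C}\rangle=\mathrm{trace}(\mathbf{B}\mathbf{C})$ is the scalar product on real symmetric matrices, and the gradient $\nabla\theta_d$ is taken on the space of symmetric matrices with this scalar product. *)

theory Defs
  imports "HOL-Analysis.Analysis"
begin

definition ell :: "nat \<Rightarrow> nat \<Rightarrow> nat" where
  "ell n d = (n + d - 1) choose d"

definition kconst :: "nat \<Rightarrow> nat \<Rightarrow> real" where
  "kconst n d = real n / (2 * real d * real (ell n d))"

definition exponents :: "nat \<Rightarrow> ('n::finite \<Rightarrow> nat) set" where
  "exponents d = {\<alpha>. (\<Sum>j\<in>UNIV. \<alpha> j) = d}"

definition monomial :: "('n::finite \<Rightarrow> nat) \<Rightarrow> real ^ 'n \<Rightarrow> real" where
  "monomial \<alpha> x = (\<Prod>j\<in>UNIV. (x $ j) ^ \<alpha> j)"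

(* The coordinates of R^ell(d) are indexed by a finite type 'm, and the map e from 'm to exponents
   fixes the order in which the monomials are listed. It is intended to be a bijection from 'm onto
   exponents d, so that CARD('m) = ell CARD('n) d. *)
definition monvec :: "('m::finite \<Rightarrow> 'n::finite \<Rightarrow> nat) \<Rightarrow> real ^ 'n \<Rightarrow> real ^ 'm" where
  "monvec e x = (\<chi> i. monomial (e i) x)"

definition sym_mats :: "(real ^ 'm ^ 'm) set" where
  "sym_mats = {A. transpose A = A}"

definition pd_mats :: "(real ^ 'm ^ 'm) set" where
  "pd_mats = {A \<in> sym_mats. \<forall>y. y \<noteq> 0 \<longrightarrow> y \<bullet> (A *v y) > 0}"

definition trace_inner :: "real ^ 'm ^ 'm \<Rightarrow> real ^ 'm ^ 'm \<Rightarrow> real" where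
  "trace_inner B C = trace (B ** C)"

(* G is the gradient at S of f, as a function on the space of symmetric matrices with scalar
   product trace_inner. Only the values of f on symmetric matrices near S matter, so f may be a
   function on pd_mats (relatively open in sym_mats) extended arbitrarily. *)
definition has_sym_gradient ::
    "(real ^ 'm ^ 'm \<Rightarrow> real) \<Rightarrow> real ^ 'm ^ 'm \<Rightarrow> real ^ 'm ^ 'm \<Rightarrow> bool" where
  "has_sym_gradient f G S \<longleftrightarrow>
     G \<in> sym_mats \<and> (f has_derivative (\<lambda>H. trace_inner G H)) (at S within sym_mats)"

definition weight ::
    "('m::finite \<Rightarrow> 'n::finite \<Rightarrow> nat) \<Rightarrow> nat \<Rightarrow> real ^ 'm ^ 'm \<Rightarrow> real ^ 'n \<Rightarrow> real" where
  "weight e d S x = exp (- kconst CARD('n) d * (monvec e x \<bullet> (S *v monvec e x)))"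

definition theta :: "('m::finite \<Rightarrow> 'n::finite \<Rightarrow> nat) \<Rightarrow> nat \<Rightarrow> real ^ 'm ^ 'm \<Rightarrow> real" where
  "theta e d S = det S powr kconst CARD('n) d * (LINT x|lborel. weight e d S x)"

definition moment_matrix ::
    "('m::finite \<Rightarrow> 'n::finite \<Rightarrow> nat) \<Rightarrow> nat \<Rightarrow> real ^ 'm ^ 'm \<Rightarrow> real ^ 'm ^ 'm" where
  "moment_matrix e d S =
     (LINT x|lborel. weight e d S x *\<^sub>R (\<chi> i j. monvec e x $ i * monvec e x $ j))
       /\<^sub>R (LINT x|lborel. weight e d S x)"

end

theory Submission
  imports Defs "HOL-Probability.Distributions"
begin

text \<open>
  Write \<open>I(S)\<close> for the integral of the weight and \<open>v\<close> for the monomial vector. The quadratic form of \<open>S\<close>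
  dominates a multiple of \<open>v \<bullet> v\<close>, so the second-order Taylor remainder of the exponential is
  integrable and \<open>I\<close> is differentiable with derivative \<open>H \<mapsto> - k I(S) \<langle>M(S), H\<rangle>\<close>. The form has degree
  \<open>2 d\<close> in \<open>x\<close>, so the substitution \<open>x \<mapsto> s x\<close> gives \<open>I(t S) = t powr (- n / (2 d)) I(S)\<close>;
  differentiating at \<open>t = 1\<close> yields \<open>\<langle>M(S), S\<rangle> = n / (2 d k)\<close>, which is \<open>\<ell>(d)\<close> by the choice of \<open>k\<close>.
  Together with Jacobi's formula for the determinant, the gradient of \<open>\<theta>\<close> at \<open>S\<close> is
  \<open>k \<theta>(S) (inverse S - M(S))\<close>.
\<close>

section \<open>Gaussian integrals\<close>

text \<open>The integrand factors over the coordinates, and each factor is a multiple of the normal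
  density with mean 0 and variance \<open>1 / (2 * c)\<close>; integrability passes to the product
  measure.\<close>

lemma integrable_exp_neg_inner:
  fixes c :: real
  assumes "c > 0"
  shows "integrable lborel (\<lambda>x::'a::euclidean_space. exp (- c * (x \<bullet> x)))"
proof -
  interpret product_sigma_finite "\<lambda>_::'a. lborel :: real measure" ..
  have "integrable lborel (\<lambda>t. sqrt (pi / c) * normal_density 0 (1 / sqrt (2 * c)) t)"
    using assms by (intro integrable_mult_right integrable_normal_density) auto
  moreover have "(\<lambda>t. sqrt (pi / c) * normal_density 0 (1 / sqrt (2 * c)) t) = (\<lambda>t. exp (- c * t\<^sup>2))"
    using assms by (auto simp: normal_density_def fun_eq_iff real_sqrt_divide field_simps power_divide)
  ultimately have "integrable lborel (\<lambda>t::real. exp (- c * t\<^sup>2))" by simp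
  then have *: "integrable (\<Pi>\<^sub>M b\<in>(Basis::'a set). lborel) (\<lambda>f. \<Prod>b\<in>Basis. exp (- c * (f b)\<^sup>2))"
    by (intro product_integrable_prod) auto
  have "exp (- c * (y \<bullet> y)) = (\<Prod>b\<in>Basis. exp (- c * (f b)\<^sup>2))"
    if "y = (\<Sum>b\<in>Basis. f b *\<^sub>R b)" for f and y :: 'a
    using that by (subst euclidean_inner)
      (simp add: inner_sum_left inner_Basis if_distrib power2_eq_square sum_negf sum_distrib_left
        cong: if_cong flip: exp_sum)
  then show ?thesis
    using * by (subst lborel_eq, subst integrable_distr_eq) auto
qed

section \<open>Bounds for quadratic forms and positive definite matrices\<close>

lemma norm_matrix_vector_mult_le:
  fixes A :: "real ^ 'n ^ 'm"
  shows "norm (A *v y) \<le> norm A * norm y"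
proof -
  have "norm (A *v y) = L2_set (\<lambda>i. \<bar>A $ i \<bullet> y\<bar>) UNIV"
    by (simp add: norm_vec_def matrix_vector_mul_component)
  also have "\<dots> \<le> L2_set (\<lambda>i. norm (A $ i) * norm y) UNIV"
    by (intro L2_set_mono) (auto simp: Cauchy_Schwarz_ineq2)
  also have "\<dots> = norm A * norm y"
    unfolding norm_vec_def[of A] by (subst L2_set_left_distrib) auto
  finally show ?thesis .
qed

lemma abs_quadratic_form_le:
  fixes A :: "real ^ 'm ^ 'm"
  shows "\<bar>y \<bullet> (A *v y)\<bar> \<le> norm A * (y \<bullet> y)"
proof -
  have "\<bar>y \<bullet> (A *v y)\<bar> \<le> norm y * norm (A *v y)"
    by (rule Cauchy_Schwarz_ineq2)
  also have "\<dots> \<le> norm y * (norm A * norm y)"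
    by (intro mult_left_mono norm_matrix_vector_mult_le) auto
  finally show ?thesis
    by (simp add: dot_square_norm power2_eq_square mult_ac)
qed

text \<open>The constant is the minimum of the form on the unit sphere, attained by compactness;
  homogeneity of degree 2 extends the bound to all vectors.\<close>

lemma quadratic_form_lower_bound:
  fixes S :: "real ^ 'm ^ 'm"
  assumes "\<And>y. y \<noteq> 0 \<Longrightarrow> y \<bullet> (S *v y) > 0"
  obtains c where "c > 0" "\<And>y. c * (y \<bullet> y) \<le> y \<bullet> (S *v y)"
proof -
  have "\<exists>x\<in>sphere 0 1. \<forall>y\<in>sphere 0 1. x \<bullet> (S *v x) \<le> y \<bullet> (S *v y)"
    by (intro continuous_attains_inf continuous_intros) auto
  then obtain x where x: "norm x = 1" "\<And>y. norm y = 1 \<Longrightarrow> x \<bullet> (S *v x) \<le> y \<bullet> (S *v y)"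
    by auto
  show thesis
  proof
    show "x \<bullet> (S *v x) > 0"
      using x(1) by (intro assms) auto
    fix y :: "real ^ 'm"
    show "(x \<bullet> (S *v x)) * (y \<bullet> y) \<le> y \<bullet> (S *v y)"
    proof (cases "y = 0")
      case False
      have "x \<bullet> (S *v x) \<le> (y /\<^sub>R norm y) \<bullet> (S *v (y /\<^sub>R norm y))"
        using False by (intro x) auto
      also have "\<dots> = (y \<bullet> (S *v y)) / (y \<bullet> y)"
        by (simp add: matrix_vector_mult_scaleR dot_square_norm power2_eq_square field_simps)
      finally show ?thesis
        using False by (simp add: field_simps)
    qed auto
  qed
qed

lemma det_pos_of_pd:
  fixes S :: "real ^ 'm ^ 'm"
  assumes "\<And>y. y \<noteq> 0 \<Longrightarrow> y \<bullet> (S *v y) > 0"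
  shows "det S > 0"
proof (rule ccontr)
  \<comment> \<open>The segment from the identity to \<open>S\<close> stays positive definite, so \<open>det\<close> has no zero on it.\<close>
  define P where "P t = (1 - t) *\<^sub>R mat 1 + t *\<^sub>R S" for t :: real
  assume "\<not> det S > 0"
  then have "det (P 1) \<le> 0" "0 \<le> det (P 0)"
    by (auto simp: P_def)
  moreover have "continuous_on {0..1} (\<lambda>t. det (P t))"
    unfolding det_def P_def
    by (intro continuous_intros)
  ultimately obtain t where t: "0 \<le> t" "t \<le> 1" "det (P t) = 0"
    using IVT2'[of "\<lambda>t. det (P t)" 1 0 0] by auto
  then have "\<not> invertible (P t)"
    by (simp add: invertible_det_nz)
  then obtain y where y: "P t *v y = 0" "y \<noteq> 0"
    by (auto simp: invertible_left_inverse matrix_left_invertible_ker)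
  have "y \<bullet> (P t *v y) = (1 - t) * (y \<bullet> y) + t * (y \<bullet> (S *v y))"
    by (simp add: P_def matrix_vector_mult_add_rdistrib inner_add_right scaleR_matrix_vector_assoc[symmetric])
  moreover have "(1 - t) * (y \<bullet> y) + t * (y \<bullet> (S *v y)) > 0"
  proof (cases "t = 1")
    case False
    then show ?thesis
      using t y assms[of y] by (intro add_pos_nonneg mult_pos_pos mult_nonneg_nonneg) auto
  qed (use assms y in auto)
  ultimately show False
    using y by simp
qed

section \<open>Jacobi's formula for the determinant\<close>

text \<open>Leibniz's formula is differentiated term by term, \<open>D p\<close> being the
  derivative of the product that belongs to \<open>p\<close>. At the identity matrix only
  \<open>p = id\<close> contributes, and it gives the sum of the diagonal entries.\<close>

lemma has_derivative_det_mat_1: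
  "((det :: real ^ 'm ^ 'm \<Rightarrow> real) has_derivative trace) (at (mat 1))"
proof -
  define D where "D p H = (\<Sum>i\<in>UNIV. H $ i $ p i * (\<Prod>j\<in>UNIV - {i}. (mat 1 :: real ^ 'm ^ 'm) $ j $ p j))"
    for p and H :: "real ^ 'm ^ 'm"
  have "((\<lambda>A::real ^ 'm ^ 'm. \<Sum>p | p permutes UNIV. of_int (sign p) * (\<Prod>i\<in>UNIV. A $ i $ p i)) has_derivative
      (\<lambda>H. \<Sum>p | p permutes UNIV. of_int (sign p) * D p H)) (at (mat 1))"
    unfolding D_def
    by (intro has_derivative_sum has_derivative_mult_right has_derivative_prod
        bounded_linear_imp_has_derivative
        bounded_linear_compose[OF bounded_linear_vec_nth bounded_linear_vec_nth])
  moreover have "(\<Sum>p | p permutes UNIV. of_int (sign p) * D p H) = trace H" for H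
  proof -
    have "of_int (sign p) * D p H = (if p = id then trace H else 0)" if "p permutes UNIV" for p
    proof (cases "p = id")
      case True
      then show ?thesis
        by (simp add: D_def trace_def sign_id mat_def)
    next
      case False
      \<comment> \<open>A permutation fixing all points but one is the identity.\<close>
      have "(\<Prod>j\<in>UNIV - {i}. (mat 1 :: real ^ 'm ^ 'm) $ j $ p j) = 0" for i
      proof -
        have "\<exists>j. j \<noteq> i \<and> p j \<noteq> j"
        proof (rule ccontr)
          assume *: "\<not> ?thesis"
          then have "p i = i"
            by (metis permutes_univ that)
          with * False show False
            by (auto simp: fun_eq_iff)
        qed
        then obtain j where "j \<noteq> i" "p j \<noteq> j"
          by blast
        then show ?thesis
          by (intro prod_zero bexI[of _ j]) (auto simp: mat_def)
      qed
      with False show ?thesis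
        by (simp add: D_def del: prod_zero_iff)
    qed
    then have "(\<Sum>p | p permutes UNIV. of_int (sign p) * D p H) =
        (\<Sum>p | p permutes (UNIV :: 'm set). if p = id then trace H else 0)"
      by (intro sum.cong) auto
    also have "\<dots> = trace H"
      by (simp add: sum.delta' finite_permutations permutes_id)
    finally show ?thesis .
  qed
  ultimately show ?thesis
    by (simp add: det_def[abs_def])
qed

lemma matrix_inv_left:
  fixes S :: "real ^ 'm ^ 'm"
  assumes "invertible S"
  shows "matrix_inv S ** S = mat 1"
  using someI_ex[OF assms[unfolded invertible_def]] unfolding matrix_inv_def by blast

lemma bounded_linear_matrix_mult_right:
  "bounded_linear (\<lambda>B::real ^ 'm ^ 'm. A ** B)"
  unfolding linear_conv_bounded_linear[symmetric]
  by (intro linearI)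
    (simp_all add: vec_eq_iff matrix_matrix_mult_def sum_distrib_left sum.distrib algebra_simps)

text \<open>Multiplicativity of \<open>det\<close> moves the base point to the identity: the map
  taking \<open>A\<close> to \<open>matrix_inv S ** A\<close> is linear and sends \<open>S\<close>
  to \<open>mat 1\<close>.\<close>

lemma has_derivative_det:
  fixes S :: "real ^ 'm ^ 'm"
  assumes "invertible S"
  shows "(det has_derivative (\<lambda>H. det S * trace (matrix_inv S ** H))) (at S)"
proof -
  have "det S * det (matrix_inv S ** A) = det A" for A
  proof -
    have "det S * det (matrix_inv S) = 1"
      using matrix_inv_left[OF assms] by (metis det_I det_mul mult.commute)
    then show ?thesis
      by (simp add: det_mul mult.assoc[symmetric])
  qed
  then have "det = (\<lambda>A. det S * det (matrix_inv S ** A))"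
    by simp
  moreover have "((\<lambda>A. det (matrix_inv S ** A)) has_derivative (\<lambda>H. trace (matrix_inv S ** H))) (at S)"
    using matrix_inv_left[OF assms] has_derivative_det_mat_1
    by (intro has_derivative_compose[where g = det and f = "\<lambda>A. matrix_inv S ** A" and g' = trace]
        bounded_linear_imp_has_derivative bounded_linear_matrix_mult_right) auto
  then have "((\<lambda>A. det S * det (matrix_inv S ** A)) has_derivative (\<lambda>H. det S * trace (matrix_inv S ** H))) (at S)"
    by (intro has_derivative_mult_right)
  ultimately show ?thesis
    by metis
qed

section \<open>Integrability of powers times decaying exponentials\<close>

text \<open>Half of the exponential decay is spent on absorbing the power.\<close>

lemma power_times_exp_le:
  fixes c u :: real
  assumes "c > 0" "u \<ge> 0"
  shows "u ^ p * exp (- c * u) \<le> (2 * (real p + 1) / c) ^ p * exp (- (c / 2) * u)"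
proof -
  \<comment> \<open>Chosen so that \<open>p * a\<close> is at most \<open>c / 2\<close>; the summand
    1 keeps the denominator positive when \<open>p = 0\<close>. The power is then controlled by
    \<open>a * u \<le> exp (a * u)\<close>.\<close>
  define a where "a = c / (2 * (real p + 1))"
  have a: "a > 0" "p * a \<le> c / 2"
    using assms by (auto simp: a_def field_simps)
  have "(a * u) ^ p \<le> exp (a * u) ^ p"
    using assms a exp_ge_add_one_self[of "a * u"] by (intro power_mono) (auto simp del: exp_ge_add_one_self)
  also have "\<dots> = exp (p * a * u)"
    by (simp add: exp_of_nat_mult mult.assoc)
  also have "\<dots> \<le> exp (c / 2 * u)"
    using assms mult_right_mono[OF a(2), of u] by simp
  finally have "u ^ p \<le> (1 / a) ^ p * exp (c / 2 * u)"
    using a by (simp add: field_simps)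
  then have "u ^ p * exp (- c * u) \<le> (1 / a) ^ p * exp (c / 2 * u) * exp (- c * u)"
    by (intro mult_right_mono) auto
  also have "\<dots> = (1 / a) ^ p * exp (- (c / 2) * u)"
    by (simp add: mult.assoc flip: exp_add)
  finally show ?thesis
    by (simp add: a_def)
qed

text \<open>Since \<open>exp (- c * u x)\<close> is integrable for every positive \<open>c\<close>,
  halving \<open>c\<close> to absorb the power still leaves an integrable majorant.\<close>

lemma integrable_power_times_exp_bound:
  fixes u :: "'a \<Rightarrow> real" and f :: "'a \<Rightarrow> 'b::{banach, second_countable_topology}"
  assumes "f \<in> borel_measurable M"
    and "\<And>c. c > 0 \<Longrightarrow> integrable M (\<lambda>x. exp (- c * u x))"
    and "\<And>x. u x \<ge> 0" and "c > 0"
    and "\<And>x. norm (f x) \<le> C * (u x ^ p * exp (- c * u x))" and "C \<ge> 0"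
  shows "integrable M f"
proof (rule Bochner_Integration.integrable_bound)
  show "integrable M (\<lambda>x. C * ((2 * (real p + 1) / c) ^ p * exp (- (c / 2) * u x)))"
    using assms by (intro integrable_mult_right assms(2)) auto
  have "norm (f x) \<le> norm (C * ((2 * (real p + 1) / c) ^ p * exp (- (c / 2) * u x)))" for x
  proof -
    have "norm (f x) \<le> C * ((2 * (real p + 1) / c) ^ p * exp (- (c / 2) * u x))"
      using assms(5) mult_left_mono[OF power_times_exp_le[OF assms(4,3)] assms(6)]
      by (rule order_trans)
    also have "\<dots> \<le> norm (C * ((2 * (real p + 1) / c) ^ p * exp (- (c / 2) * u x)))"
      by simp
    finally show ?thesis .
  qed
  then show "AE x in M. norm (f x) \<le> norm (C * ((2 * (real p + 1) / c) ^ p * exp (- (c / 2) * u x)))"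
    by (rule AE_I2)
qed fact

lemma borel_measurable_quadratic_form [measurable (raw)]:
  fixes v :: "'a \<Rightarrow> real ^ 'm"
  assumes [measurable]: "v \<in> borel_measurable M"
  shows "(\<lambda>x. v x \<bullet> (A *v v x)) \<in> borel_measurable M"
proof -
  have "(\<lambda>x. A *v v x) \<in> borel_measurable M"
    by (rule borel_measurable_continuous_on[OF _ assms]) (intro continuous_intros)
  then show ?thesis by measurable
qed

section \<open>Integrals of exponentials of a quadratic form in a general map
  \<open>v\<close>\<close>

context
  fixes v :: "'a::euclidean_space \<Rightarrow> real ^ 'm" and k :: real
  assumes v [measurable]: "v \<in> borel_measurable borel"
    and int_exp: "\<And>c. c > 0 \<Longrightarrow> integrable lborel (\<lambda>x. exp (- c * (v x \<bullet> v x)))"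
    and k: "k > 0"
begin

text \<open>The lower bound for the form of \<open>S\<close> replaces the weight by an exponential
  in \<open>v x \<bullet> v x\<close> alone, with decay rate \<open>k * c\<close>.\<close>

lemma integrable_times_exp_quadratic:
  fixes f :: "'a \<Rightarrow> 'b::{banach, second_countable_topology}"
  assumes "\<And>y. y \<noteq> 0 \<Longrightarrow> y \<bullet> (S *v y) > 0"
    and "f \<in> borel_measurable lborel"
    and "\<And>x. norm (f x) \<le> C * (v x \<bullet> v x) ^ p"
  shows "integrable lborel (\<lambda>x. exp (- k * (v x \<bullet> (S *v v x))) *\<^sub>R f x)"
proof -
  obtain c where c: "c > 0" "\<And>y. c * (y \<bullet> y) \<le> y \<bullet> (S *v y)"
    using quadratic_form_lower_bound[OF assms(1)] by metis
  show ?thesis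
  \<comment> \<open>The sign of \<open>C\<close> is not assumed, whereas the majorant needs a
    nonnegative factor; hence \<open>\<bar>C\<bar>\<close>.\<close>
  proof (rule integrable_power_times_exp_bound[where u = "\<lambda>x. v x \<bullet> v x" and C = "\<bar>C\<bar>" and c = "k * c"])
    fix x
    have "exp (- k * (v x \<bullet> (S *v v x))) \<le> exp (- (k * c) * (v x \<bullet> v x))"
      using c(2)[of "v x"] k by (simp add: mult.assoc)
    moreover have "norm (f x) \<le> \<bar>C\<bar> * (v x \<bullet> v x) ^ p"
      using assms(3)[of x] by (rule order_trans) (intro mult_right_mono, auto)
    ultimately have "exp (- k * (v x \<bullet> (S *v v x))) * norm (f x) \<le>
        exp (- (k * c) * (v x \<bullet> v x)) * (\<bar>C\<bar> * (v x \<bullet> v x) ^ p)"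
      by (intro mult_mono) auto
    then show "norm (exp (- k * (v x \<bullet> (S *v v x))) *\<^sub>R f x) \<le>
        \<bar>C\<bar> * ((v x \<bullet> v x) ^ p * exp (- (k * c) * (v x \<bullet> v x)))"
      by (simp add: mult_ac)
  qed (use assms(2) c k int_exp in auto)
qed

text \<open>A nonnegative integrand with integral 0 vanishes almost everywhere, but the exponential
  vanishes nowhere and the whole space is not a null set.\<close>

lemma integral_exp_quadratic_pos:
  assumes "\<And>y. y \<noteq> 0 \<Longrightarrow> y \<bullet> (S *v y) > 0"
  shows "(LINT x|lborel. exp (- k * (v x \<bullet> (S *v v x)))) > 0"
proof -
  have int: "integrable lborel (\<lambda>x. exp (- k * (v x \<bullet> (S *v v x))))"
    using integrable_times_exp_quadratic[OF assms, of "\<lambda>_. 1 :: real" 1 0] by simp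
  have "(LINT x|lborel. exp (- k * (v x \<bullet> (S *v v x)))) \<noteq> 0"
  proof
    assume "(LINT x|lborel. exp (- k * (v x \<bullet> (S *v v x)))) = 0"
    then have "AE x in (lborel :: 'a measure). False"
      using int by (subst (asm) integral_nonneg_eq_0_iff_AE) auto
    then show False
      by (simp add: AE_iff_null emeasure_lborel_UNIV null_sets_def)
  qed
  moreover have "(LINT x|lborel. exp (- k * (v x \<bullet> (S *v v x)))) \<ge> 0"
    by (intro Bochner_Integration.integral_nonneg) auto
  ultimately show ?thesis by linarith
qed

text \<open>Differentiation under the integral sign, carried out by bounding the remainder by a
  constant times \<open>(norm H)\<^sup>2\<close>; linearity of the candidate derivative comes from
  linearity of the form in its matrix.\<close>

lemma has_derivative_integral_exp_quadratic:
  assumes pd: "\<And>y. y \<noteq> 0 \<Longrightarrow> y \<bullet> (S *v y) > 0"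
  shows "((\<lambda>S. LINT x|lborel. exp (- k * (v x \<bullet> (S *v v x)))) has_derivative
     (\<lambda>H. - k * (LINT x|lborel. exp (- k * (v x \<bullet> (S *v v x))) * (v x \<bullet> (H *v v x))))) (at S)"
proof -
  define q where "q A x = v x \<bullet> (A *v v x)" for A x
  define I where "I A = (LINT x|lborel. exp (- k * q A x))" for A
  define L where "L H = (LINT x|lborel. exp (- k * q S x) * q H x)" for H
  obtain c where c: "c > 0" "\<And>y. c * (y \<bullet> y) \<le> y \<bullet> (S *v y)"
    using quadratic_form_lower_bound[OF pd] by metis
  have q_meas [measurable]: "q A \<in> borel_measurable borel" for A
    unfolding q_def by measurable
  have q_add: "q (A + B) x = q A x + q B x" for A B x
    by (simp add: q_def matrix_vector_mult_add_rdistrib inner_add_right)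
  have q_scaleR: "q (r *\<^sub>R A) x = r * q A x" for r A x
    by (simp add: q_def scaleR_matrix_vector_assoc[symmetric])
  have q_le: "\<bar>q A x\<bar> \<le> norm A * (v x \<bullet> v x)" for A x
    unfolding q_def by (rule abs_quadratic_form_le)
  have int_q: "integrable lborel (\<lambda>x. exp (- k * q S x) * q H x)" for H
    using integrable_times_exp_quadratic[OF pd, of "q H" "norm H" 1] q_le
    by (simp add: q_def)
  have int_1: "integrable lborel (\<lambda>x. exp (- k * q S x))"
    using integrable_times_exp_quadratic[OF pd, of "\<lambda>_. 1 :: real" 1 0] by (simp add: q_def)
  \<comment> \<open>Integral of the majorant of the remainder: the square stems from the
    second-order Taylor term, and \<open>k * c / 2\<close> is the decay left after the perturbation
    by \<open>H\<close>.\<close>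
  define B where "B = (LINT x|lborel. (v x \<bullet> v x)\<^sup>2 * exp (- (k * c / 2) * (v x \<bullet> v x)))"
  have int_B: "integrable lborel (\<lambda>x. (v x \<bullet> v x)\<^sup>2 * exp (- (k * c / 2) * (v x \<bullet> v x)))"
    by (rule integrable_power_times_exp_bound[where u = "\<lambda>x. v x \<bullet> v x" and p = 2 and C = 1 and c = "k * c / 2"])
       (use c k int_exp in auto)
  have lin_L: "linear L"
  proof (rule linearI)
    show "L (A + B) = L A + L B" for A B
      by (simp only: L_def q_add distrib_left Bochner_Integration.integral_add[OF int_q int_q])
    show "L (r *\<^sub>R A) = r *\<^sub>R L A" for r A
      by (simp add: L_def q_scaleR mult.left_commute)
  qed

  \<comment> \<open>For \<open>norm H \<le> c / 2\<close> the factor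
    \<open>exp \<bar>k * q H x\<bar>\<close> from Taylor's bound grows at rate at most
    \<open>k * c / 2\<close>, which cancels only half of the decay \<open>k * c\<close> supplied by
    \<open>S\<close>.\<close>
  have remainder: "\<bar>I (S + H) - I S + k * L H\<bar> \<le> k\<^sup>2 * B * (norm H)\<^sup>2" if H: "norm H \<le> c / 2" for H
  proof -
    have pointwise: "\<bar>exp (- k * q (S + H) x) - exp (- k * q S x) + k * (exp (- k * q S x) * q H x)\<bar>
        \<le> k\<^sup>2 * (norm H)\<^sup>2 * ((v x \<bullet> v x)\<^sup>2 * exp (- (k * c / 2) * (v x \<bullet> v x)))" for x
    proof -
      let ?u = "v x \<bullet> v x" and ?z = "- k * q H x"
      have z: "\<bar>?z\<bar> \<le> k * norm H * ?u"
        using q_le[of H x] k by (simp add: abs_mult mult.assoc)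
      have "exp (- k * q (S + H) x) - exp (- k * q S x) + k * (exp (- k * q S x) * q H x) =
          exp (- k * q S x) * (exp ?z - (1 + ?z))"
        by (simp add: q_add algebra_simps flip: exp_add)
      then have "\<bar>exp (- k * q (S + H) x) - exp (- k * q S x) + k * (exp (- k * q S x) * q H x)\<bar> =
          exp (- k * q S x) * \<bar>exp ?z - (1 + ?z)\<bar>"
        by (simp add: abs_mult)
      also have "\<dots> \<le> exp (- (k * c) * ?u) * (exp (k * c / 2 * ?u) * (k * norm H * ?u)\<^sup>2)"
      proof (rule mult_mono)
        show "exp (- k * q S x) \<le> exp (- (k * c) * ?u)"
          using c(2)[of "v x"] k by (simp add: q_def mult.assoc)
        have "\<bar>exp ?z - (1 + ?z)\<bar> \<le> exp \<bar>?z\<bar> * \<bar>?z\<bar>\<^sup>2"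
          using Taylor_exp_field[of ?z 1] by (simp add: numeral_2_eq_2)
        also have "\<dots> \<le> exp (k * c / 2 * ?u) * (k * norm H * ?u)\<^sup>2"
        proof (intro mult_mono power_mono)
          have "k * norm H * ?u \<le> k * (c / 2) * ?u"
            using H k by (intro mult_right_mono mult_left_mono) auto
          with z show "exp \<bar>?z\<bar> \<le> exp (k * c / 2 * ?u)"
            by simp
        qed (use z in auto)
        finally show "\<bar>exp ?z - (1 + ?z)\<bar> \<le> exp (k * c / 2 * ?u) * (k * norm H * ?u)\<^sup>2" .
      qed auto
      also have "\<dots> = k\<^sup>2 * (norm H)\<^sup>2 * (?u\<^sup>2 * (exp (- (k * c) * ?u) * exp (k * c / 2 * ?u)))"
        by (simp add: power_mult_distrib mult_ac)
      also have "exp (- (k * c) * ?u) * exp (k * c / 2 * ?u) = exp (- (k * c / 2) * ?u)"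
        by (simp flip: exp_add)
      finally show ?thesis .
    qed
    let ?R = "\<lambda>x. exp (- k * q (S + H) x) - exp (- k * q S x) + k * (exp (- k * q S x) * q H x)"
    have int_R: "integrable lborel ?R"
      by (rule Bochner_Integration.integrable_bound[OF integrable_mult_right[OF int_B, of "k\<^sup>2 * (norm H)\<^sup>2"]])
        (use pointwise in \<open>auto intro!: AE_I2 simp: abs_mult\<close>)
    \<comment> \<open>Integrability of the exponential at \<open>S + H\<close> is recovered from
      that of the remainder by adding back the other two terms, without first proving
      \<open>S + H\<close> positive definite.\<close>
    have "integrable lborel (\<lambda>x. ?R x + exp (- k * q S x) - k * (exp (- k * q S x) * q H x))"
      by (intro Bochner_Integration.integrable_add Bochner_Integration.integrable_diff int_R int_1 integrable_mult_right int_q)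
    then have "integrable lborel (\<lambda>x. exp (- k * q (S + H) x))"
      by simp
    then have "I (S + H) - I S + k * L H = (LINT x|lborel. ?R x)"
      using int_1 int_q[of H] by (simp add: I_def L_def)
    then have "\<bar>I (S + H) - I S + k * L H\<bar> = \<bar>LINT x|lborel. ?R x\<bar>"
      by (rule arg_cong)
    also have "\<dots> \<le> (LINT x|lborel. \<bar>?R x\<bar>)"
      by (rule integral_abs_bound)
    also have "\<dots> \<le> (LINT x|lborel. k\<^sup>2 * (norm H)\<^sup>2 * ((v x \<bullet> v x)\<^sup>2 * exp (- (k * c / 2) * (v x \<bullet> v x))))"
      by (rule integral_mono[OF integrable_abs[OF int_R] integrable_mult_right[OF int_B] pointwise])
    also have "\<dots> = k\<^sup>2 * B * (norm H)\<^sup>2"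
      by (simp add: B_def)
    finally show ?thesis .
  qed

  have "(I has_derivative (\<lambda>H. - k * L H)) (at S)"
  proof (rule has_derivativeI_sandwich[where e = "c / 2" and H = "\<lambda>A. k\<^sup>2 * B * norm (A - S)"])
    show "bounded_linear (\<lambda>H. - k * L H)"
      by (rule bounded_linear_const_mult[OF lin_L[unfolded linear_conv_bounded_linear]])
    show "norm (I A - I S - - k * L (A - S)) / norm (A - S) \<le> k\<^sup>2 * B * norm (A - S)"
      if "A \<noteq> S" "dist A S < c / 2" for A
      using remainder[of "A - S"] that by (simp add: dist_norm divide_le_eq power2_eq_square mult_ac)
    show "((\<lambda>A. k\<^sup>2 * B * norm (A - S)) \<longlongrightarrow> 0) (at S)"
      by (auto intro!: tendsto_eq_intros)
  qed (use c in auto)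
  then show ?thesis
    by (simp add: I_def[abs_def] L_def[abs_def] q_def[abs_def])
qed

end

section \<open>Scaling, growth of the monomial vector, and positivity of the constants\<close>

lemma integral_lborel_scaleR:
  fixes f :: "'a::euclidean_space \<Rightarrow> real"
  assumes [measurable]: "f \<in> borel_measurable borel" and "s > 0"
  shows "(LINT x|lborel. f (s *\<^sub>R x)) = (LINT x|lborel. f x) / s ^ DIM('a)"
proof -
  have "(LINT x|lborel. f x) =
      (LINT x|density (distr lborel borel (\<lambda>x::'a. 0 + s *\<^sub>R x)) (\<lambda>_. ennreal (\<bar>s\<bar> ^ DIM('a))). f x)"
    using assms by (subst lborel_affine[of s 0]) (auto simp: ennreal_power)
  also have "\<dots> = s ^ DIM('a) * (LINT x|lborel. f (s *\<^sub>R x))"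
    using assms by (simp add: integral_density integral_distr)
  finally show ?thesis
    using assms by simp
qed

lemma monomial_scaleR:
  assumes "\<alpha> \<in> exponents d"
  shows "monomial \<alpha> (s *\<^sub>R x) = s ^ d * monomial \<alpha> x"
  using assms by (auto simp: monomial_def exponents_def power_mult_distrib prod.distrib simp flip: power_sum)

lemma continuous_on_monvec: "continuous_on A (monvec e)"
  unfolding monvec_def monomial_def by (intro continuous_intros)

lemma borel_measurable_monvec [measurable]: "monvec e \<in> borel_measurable borel"
  by (intro borel_measurable_continuous_onI continuous_on_monvec)

text \<open>The pure powers \<open>(x $ j) ^ d\<close> occur among the monomials, and
  \<open>u - 1 \<le> u ^ d\<close> for \<open>u = (x $ j)\<^sup>2\<close>. The bound makes a
  Gaussian dominate \<open>exp (- c * (monvec e x \<bullet> monvec e x))\<close>.\<close>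

lemma inner_self_le_monvec:
  fixes e :: "'m::finite \<Rightarrow> 'n::finite \<Rightarrow> nat"
  assumes "d \<ge> 1" and "exponents d \<subseteq> range e"
  shows "x \<bullet> x - CARD('n) \<le> monvec e x \<bullet> monvec e x"
proof -
  \<comment> \<open>\<open>\<alpha> j\<close> is the exponent of the \<open>d\<close>-th power of
    the \<open>j\<close>-th variable, and \<open>f j\<close> is a coordinate that carries this
    monomial.\<close>
  define \<alpha> where "\<alpha> j = (\<lambda>i. if i = j then d else 0)" for j :: 'n
  define f where "f j = inv e (\<alpha> j)" for j
  have "\<alpha> j \<in> range e" for j
    using assms(2) by (auto simp: \<alpha>_def exponents_def)
  then have f: "e (f j) = \<alpha> j" for j
    by (simp add: f_def f_inv_into_f)
  \<comment> \<open>Distinct variables thus occupy distinct coordinates, so no square is counted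
    twice below. For \<open>d = 0\<close> all \<open>\<alpha> j\<close> would coincide.\<close>
  have "inj f"
  proof (rule injI)
    fix i j
    assume "f i = f j"
    then have "\<alpha> i i = \<alpha> j i"
      by (metis f)
    then show "i = j"
      using assms(1) by (auto simp: \<alpha>_def split: if_splits)
  qed
  have "x \<bullet> x - CARD('n) = (\<Sum>j\<in>UNIV. (x $ j)\<^sup>2 - 1)"
    by (simp add: inner_vec_def sum_subtractf power2_eq_square)
  also have "\<dots> \<le> (\<Sum>j\<in>UNIV. (monvec e x $ f j)\<^sup>2)"
  proof (rule sum_mono)
    fix j
    have "monvec e x $ f j = (x $ j) ^ d"
      by (simp add: monvec_def monomial_def f \<alpha>_def if_distrib[of "(^) _"] cong: if_cong)
    moreover have "u - 1 \<le> u ^ d" if "u \<ge> 0" for u :: real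
      using assms(1) that power_increasing[of 1 d u] zero_le_power[OF that, of d]
      by (cases "u \<ge> 1") (auto intro: order_trans[of _ 0])
    ultimately show "(x $ j)\<^sup>2 - 1 \<le> (monvec e x $ f j)\<^sup>2"
      by (metis power_commutes power_mult mult.commute zero_le_power2)
  qed
  also have "\<dots> = (\<Sum>i\<in>range f. (monvec e x $ i)\<^sup>2)"
    by (simp add: sum.reindex[OF \<open>inj f\<close>])
  also have "\<dots> \<le> (\<Sum>i\<in>UNIV. (monvec e x $ i)\<^sup>2)"
    by (rule sum_mono2) auto
  also have "\<dots> = monvec e x \<bullet> monvec e x"
    by (simp add: inner_vec_def power2_eq_square)
  finally show ?thesis .
qed

lemma integrable_exp_monvec:
  fixes e :: "'m::finite \<Rightarrow> 'n::finite \<Rightarrow> nat"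
  assumes "d \<ge> 1" and "exponents d \<subseteq> range e" and "c > 0"
  shows "integrable lborel (\<lambda>x. exp (- c * (monvec e x \<bullet> monvec e x)))"
proof (rule Bochner_Integration.integrable_bound)
  show "integrable lborel (\<lambda>x::real ^ 'n. exp (c * CARD('n)) * exp (- c * (x \<bullet> x)))"
    using assms by (intro integrable_mult_right integrable_exp_neg_inner)
  show "AE x in lborel. norm (exp (- c * (monvec e x \<bullet> monvec e x)))
      \<le> norm (exp (c * CARD('n)) * exp (- c * (x \<bullet> x)))"
    using mult_left_mono[OF inner_self_le_monvec[OF assms(1,2)], of c] assms(3)
    by (intro AE_I2) (simp add: algebra_simps flip: exp_add)
qed measurable

lemma ell_pos: "ell CARD('n::finite) d > 0"
proof -
  have "CARD('n) \<ge> 1"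
    by (simp add: Suc_leI)
  then have "d \<le> CARD('n) + d - 1"
    by linarith
  then show ?thesis
    by (simp add: ell_def)
qed

lemma kconst_pos:
  assumes "d \<ge> 1"
  shows "kconst CARD('n::finite) d > 0"
  using assms ell_pos[where 'n = 'n, of d] by (simp add: kconst_def)

section \<open>The trace scalar product and rank-one matrices\<close>

text \<open>Turns the quadratic forms in the derivative of the weight integral into scalar products
  with the integrand of the moment matrix.\<close>

lemma trace_inner_outer:
  "trace_inner (\<chi> i j. y $ i * y $ j) H = y \<bullet> (H *v y)"
proof -
  have "trace_inner (\<chi> i j. y $ i * y $ j) H = (\<Sum>i\<in>UNIV. \<Sum>j\<in>UNIV. y $ i * y $ j * H $ j $ i)"
    by (simp add: trace_inner_def trace_def matrix_matrix_mult_def)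
  also have "\<dots> = (\<Sum>j\<in>UNIV. \<Sum>i\<in>UNIV. y $ i * y $ j * H $ j $ i)"
    by (rule sum.swap)
  also have "\<dots> = y \<bullet> (H *v y)"
    by (simp add: inner_vec_def matrix_vector_mult_def sum_distrib_left mult_ac)
  finally show ?thesis .
qed

text \<open>The rows are the multiples \<open>y $ i *\<^sub>R y\<close>. This supplies the growth
  bound with \<open>C = 1\<close> and \<open>p = 1\<close> for the integrand of the moment
  matrix.\<close>

lemma norm_outer:
  fixes y :: "real ^ 'm"
  shows "norm (\<chi> i j. y $ i * y $ j) = y \<bullet> y"
proof -
  have "(\<chi> j. y $ i * y $ j) = y $ i *\<^sub>R y" for i
    by (simp add: vec_eq_iff)
  then have "norm (\<chi> i j. y $ i * y $ j) = L2_set (\<lambda>i. norm (y $ i) * norm y) UNIV"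
    by (subst norm_vec_def) simp
  also have "\<dots> = norm y * norm y"
    unfolding norm_vec_def[of y] by (subst L2_set_left_distrib) auto
  finally show ?thesis
    by (simp add: dot_square_norm power2_eq_square)
qed

lemma bounded_linear_trace_inner: "bounded_linear (\<lambda>C::real ^ 'm ^ 'm. trace_inner C H)"
  unfolding linear_conv_bounded_linear[symmetric]
  by (intro linearI)
    (simp_all add: trace_inner_def trace_def matrix_matrix_mult_def sum_distrib_left sum.distrib algebra_simps)

section \<open>The weight integral, the moment matrix and \<open>theta\<close>\<close>

context
  fixes e :: "'m::finite \<Rightarrow> 'n::finite \<Rightarrow> nat" and d :: nat
  assumes d: "d \<ge> 1" and e: "range e = exponents d"
begin

lemma monvec_scaleR: "monvec e (s *\<^sub>R x) = s ^ d *\<^sub>R monvec e x"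
  using e by (auto simp: monvec_def vec_eq_iff intro!: monomial_scaleR)

lemmas int_exp = integrable_exp_monvec[OF d equalityD2[OF e]]
lemmas k_pos = kconst_pos[OF d, where 'n = 'n]

lemma integral_weight_pos:
  assumes "S \<in> pd_mats"
  shows "(LINT x|lborel. weight e d S x) > 0"
  unfolding weight_def using assms
  by (intro integral_exp_quadratic_pos borel_measurable_monvec int_exp k_pos) (auto simp: pd_mats_def)

lemma has_derivative_integral_weight:
  assumes "S \<in> pd_mats"
  shows "((\<lambda>S. LINT x|lborel. weight e d S x) has_derivative
    (\<lambda>H. - kconst CARD('n) d * (LINT x|lborel. weight e d S x * (monvec e x \<bullet> (H *v monvec e x))))) (at S)"
  unfolding weight_def using assms
  by (intro has_derivative_integral_exp_quadratic borel_measurable_monvec int_exp k_pos)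
    (auto simp: pd_mats_def)

text \<open>The scalar product with \<open>H\<close> is a bounded linear map, so it commutes with
  the matrix-valued integral once the latter is known to converge.\<close>

lemma trace_inner_moment_matrix:
  assumes "S \<in> pd_mats"
  shows "trace_inner (moment_matrix e d S) H =
    (LINT x|lborel. weight e d S x * (monvec e x \<bullet> (H *v monvec e x))) / (LINT x|lborel. weight e d S x)"
proof -
  interpret bounded_linear "\<lambda>C. trace_inner C H"
    by (rule bounded_linear_trace_inner)
  have "(\<lambda>x. \<chi> i j. monvec e x $ i * monvec e x $ j) \<in> borel_measurable borel"
    by (intro borel_measurable_continuous_onI continuous_intros continuous_on_monvec)
  then have "integrable lborel (\<lambda>x. weight e d S x *\<^sub>R (\<chi> i j. monvec e x $ i * monvec e x $ j))"
    unfolding weight_def using assms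
    by (intro integrable_times_exp_quadratic[where C = 1 and p = 1] borel_measurable_monvec int_exp k_pos)
      (auto simp: pd_mats_def norm_outer)
  then show ?thesis
    by (simp add: moment_matrix_def scaleR trace_inner_outer divide_inverse mult.commute
        flip: integral_bounded_linear[OF bounded_linear_axioms])
qed

text \<open>With \<open>s\<close> the \<open>2 * d\<close>-th root of \<open>t\<close>, the form of
  \<open>t *\<^sub>R S\<close> at \<open>x\<close> is the form of \<open>S\<close> at
  \<open>s *\<^sub>R x\<close>; the change of variables contributes \<open>s ^ CARD('n)\<close> in
  the denominator.\<close>

lemma integral_weight_scaleR:
  assumes "t > 0"
  shows "(LINT x|lborel. weight e d (t *\<^sub>R S) x) =
    t powr (- (real CARD('n) / (2 * d))) * (LINT x|lborel. weight e d S x)"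
proof -
  define s where "s = t powr (1 / (2 * d))"
  have s: "s > 0"
    using assms by (simp add: s_def)
  have s_power: "s ^ m = t powr (real m / (2 * d))" for m
  proof -
    have "s ^ m = s powr real m"
      using s by (simp add: powr_realpow)
    then show ?thesis
      by (simp add: s_def powr_powr)
  qed
  have "s ^ (2 * d) = t"
    using assms d by (subst s_power) simp
  then have "s ^ d * s ^ d = t"
    by (simp add: mult_2 power_add)
  then have "weight e d (t *\<^sub>R S) x = weight e d S (s *\<^sub>R x)" for x
    by (simp add: weight_def monvec_scaleR scaleR_matrix_vector_assoc[symmetric]
        matrix_vector_mult_scaleR mult.assoc[symmetric])
  moreover have "weight e d S \<in> borel_measurable borel"
    unfolding weight_def by measurable
  ultimately have "(LINT x|lborel. weight e d (t *\<^sub>R S) x) = (LINT x|lborel. weight e d S x) / s ^ CARD('n)"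
    using s by (simp add: integral_lborel_scaleR)
  also have "s ^ CARD('n) = t powr (real CARD('n) / (2 * d))"
    by (rule s_power)
  finally show ?thesis
    by (simp add: powr_minus_divide)
qed

text \<open>Euler's identity for the homogeneous function \<open>I\<close>: its derivative along the
  ray through \<open>S\<close> is computed once by the chain rule and once from the power
  law.\<close>

lemma trace_inner_moment_matrix_self:
  assumes S: "S \<in> pd_mats"
  shows "trace_inner (moment_matrix e d S) S = ell CARD('n) d"
proof -
  let ?k = "kconst CARD('n) d" and ?r = "real CARD('n) / (2 * d)"
  define I where "I A = (LINT x|lborel. weight e d A x)" for A
  define J where "J H = (LINT x|lborel. weight e d S x * (monvec e x \<bullet> (H *v monvec e x)))" for H
  have "((\<lambda>t. I (t *\<^sub>R S)) has_derivative (\<lambda>h. - ?k * J (h *\<^sub>R S))) (at 1)"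
  proof (rule has_derivative_compose[where f = "\<lambda>t::real. t *\<^sub>R S"])
    show "((\<lambda>t. t *\<^sub>R S) has_derivative (\<lambda>h. h *\<^sub>R S)) (at 1)"
      by (auto intro!: derivative_eq_intros)
    show "(I has_derivative (\<lambda>H. - ?k * J H)) (at (1 *\<^sub>R S))"
      using has_derivative_integral_weight[OF S] by (simp add: I_def[abs_def] J_def)
  qed
  moreover have "- ?k * J (h *\<^sub>R S) = - ?k * J S * h" for h
    by (simp add: J_def scaleR_matrix_vector_assoc[symmetric] mult.left_commute mult.commute[of _ h])
  ultimately have "((\<lambda>t. I (t *\<^sub>R S)) has_field_derivative - ?k * J S) (at 1)"
    by (simp only: has_field_derivative_def)
  moreover have "((\<lambda>t. I (t *\<^sub>R S)) has_field_derivative - ?r * I S) (at 1)"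
  \<comment> \<open>The power law is available only for positive \<open>t\<close>, an open set
    around 1.\<close>
  proof (rule has_field_derivative_transform_within_open[where S = "{0<..}"])
    show "((\<lambda>t. t powr (- ?r) * I S) has_field_derivative - ?r * I S) (at 1)"
      by (auto intro!: derivative_eq_intros)
  qed (auto simp: I_def integral_weight_scaleR)
  ultimately have "- ?k * J S = - ?r * I S"
    by (rule DERIV_unique)
  then have "?k * J S = ?r * I S"
    by simp
  moreover have "ell CARD('n) d > 0"
    by (rule ell_pos)
  moreover have "I S > 0"
    unfolding I_def by (rule integral_weight_pos[OF S])
  \<comment> \<open>The quotient \<open>J S / I S\<close> equals \<open>?r / ?k\<close>, which is
    \<open>ell CARD('n) d\<close> by the definition of \<open>kconst\<close>.\<close>
  ultimately show ?thesis
    using d by (simp add: trace_inner_moment_matrix[OF S] kconst_def I_def[symmetric] J_def[symmetric] field_simps)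
qed

text \<open>Product rule: the determinant factor contributes \<open>matrix_inv S\<close> and the
  weight integral contributes the moment matrix with opposite sign. The derivative is taken in the
  space of all square matrices.\<close>

lemma has_derivative_theta:
  assumes S: "S \<in> pd_mats"
  shows "(theta e d has_derivative
    (\<lambda>H. kconst CARD('n) d * theta e d S * trace_inner (matrix_inv S - moment_matrix e d S) H)) (at S)"
proof -
  let ?k = "kconst CARD('n) d"
  define I where "I A = (LINT x|lborel. weight e d A x)" for A
  have det: "det S > 0"
    using S by (intro det_pos_of_pd) (auto simp: pd_mats_def)
  then have "(det has_derivative (\<lambda>H. det S * trace_inner (matrix_inv S) H)) (at S)"
    unfolding trace_inner_def by (intro has_derivative_det) (simp add: invertible_det_nz)
  \<comment> \<open>The summand with \<open>0 * ln (det S)\<close> is the contribution of the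
    exponent, which is constant.\<close>
  then have "((\<lambda>A. det A powr ?k) has_derivative
      (\<lambda>H. det S powr ?k * (0 * ln (det S) + (det S * trace_inner (matrix_inv S) H) * ?k / det S))) (at S)"
    using det by (intro has_derivative_powr) auto
  then have "((\<lambda>A. det A powr ?k) has_derivative
      (\<lambda>H. ?k * det S powr ?k * trace_inner (matrix_inv S) H)) (at S)"
    using det by (simp add: field_simps)
  moreover have "I S > 0"
    unfolding I_def by (rule integral_weight_pos[OF S])
  then have "(I has_derivative (\<lambda>H. - ?k * (I S * trace_inner (moment_matrix e d S) H))) (at S)"
    using has_derivative_integral_weight[OF S]
    by (simp add: I_def[abs_def] trace_inner_moment_matrix[OF S])
  ultimately have "((\<lambda>A. det A powr ?k * I A) has_derivative
      (\<lambda>H. det S powr ?k * (- ?k * (I S * trace_inner (moment_matrix e d S) H)) +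
        ?k * det S powr ?k * trace_inner (matrix_inv S) H * I S)) (at S)"
    by (rule has_derivative_mult)
  moreover have "theta e d = (\<lambda>A. det A powr ?k * I A)"
    by (simp add: fun_eq_iff theta_def I_def)
  ultimately show ?thesis
    by (simp add: linear_diff[OF bounded_linear.linear[OF bounded_linear_trace_inner]] algebra_simps)
qed

end

theorem lemma2p9:
  fixes e :: "'m::finite \<Rightarrow> 'n::finite \<Rightarrow> nat" and d :: nat
  assumes "d \<ge> 1"
    and "bij_betw e UNIV (exponents d)"
  shows "(\<forall>S \<in> pd_mats. trace_inner (moment_matrix e d S) S = real (ell CARD('n) d))
    \<and> (\<forall>S \<in> pd_mats. moment_matrix e d S = matrix_inv S \<longrightarrow> has_sym_gradient (theta e d) 0 S)"
proof (intro conjI ballI impI)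
  have e: "range e = exponents d"
    using assms(2) by (rule bij_betw_imp_surj_on)
  fix S :: "real ^ 'm ^ 'm"
  assume S: "S \<in> pd_mats"
  show "trace_inner (moment_matrix e d S) S = real (ell CARD('n) d)"
    by (rule trace_inner_moment_matrix_self[OF assms(1) e S])
  have zero: "trace_inner 0 H = 0" for H :: "real ^ 'm ^ 'm"
    by (rule linear_0[OF bounded_linear.linear[OF bounded_linear_trace_inner]])
  \<comment> \<open>The difference of the two matrices is 0, so the derivative is the zero map, and
    it restricts from all matrices to the symmetric ones.\<close>
  show "has_sym_gradient (theta e d) 0 S" if "moment_matrix e d S = matrix_inv S"
    using has_derivative_theta[OF assms(1) e S] that
    by (auto simp: has_sym_gradient_def sym_mats_def transpose_def vec_eq_iff zero
        intro: has_derivative_at_withinI)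
qed

end
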